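(* For all $\mu', \mu'' \in \mathbb R$ satisfying $|\mu'|<|\mu''|$, we have $(|W_n^{\mu'}|)_{n\geq 0} \preceq_{st} (|W_n^{\mu''}|)_{n\geq 0}$. Consequently, $(|W_n^\mu|)_{n\geq 0}$ is stochastically decreasing in $\mu \in (-\infty, 0]$ and increasing in $\mu \in [0,\infty)$ (with respect to $\preceq_{st}$).
   Context: For $\mu\in\mathbb R$, $(W_n^\mu)_{n\ge0}$ is the normal random walk $W_0^\mu=0$, $W_n^\mu=Z_1^\mu+\cdots+Z_n^\mu$ ($n\ge1$), where $Z_1^\mu,Z_2^\mu,\dots$ are independent and normally distributed with common mean $\mu$ and variance $1$. Stochastic order: for infinite-dimensional random vectors $\mathbf U=(U_n)_{n\ge0}$ and $\mathbf V=(V_n)_{n\ge0}$ (random elements of $\mathbb R^\infty$ with the product topology and its Borel $\sigma$-field), $\mathbf U\preceq_{st}\mathbf V$ means $E f(\mathbf U)\le E f(\mathbf V)$ for all bounded increasing measurable $f:\mathbb R^\infty\to\mathbb R$, where $f$ is increasing if $f(x_0,x_1,\dots)\le f(y_0,y_1,\dots)$ whenever $x_i\le y_i$ for all $i$. The random vectors need not be defined on the same probability space. "Increasing" and "decreasing" are meant in the non-strict sense. *)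

theory Defs
  imports "HOL-Probability.Probability"
begin

definition normal_steps :: "'a measure \<Rightarrow> real \<Rightarrow> (nat \<Rightarrow> 'a \<Rightarrow> real) \<Rightarrow> bool" where
  "normal_steps M \<mu> Z \<longleftrightarrow>
     prob_space M \<and>
     prob_space.indep_vars M (\<lambda>_. borel) Z {1..} \<and>
     (\<forall>n\<ge>1. distributed M lborel (Z n) (normal_density \<mu> 1))"

definition walk :: "(nat \<Rightarrow> 'a \<Rightarrow> real) \<Rightarrow> nat \<Rightarrow> 'a \<Rightarrow> real" where
  "walk Z n \<omega> = (\<Sum>i=1..n. Z i \<omega>)"

text \<open>On \<^typ>\<open>nat \<Rightarrow> real\<close>, the library's topology is the product topology (so \<^const>\<open>borel\<close>
  is its Borel sigma-algebra) and the library's order is the pointwise one (so \<^const>\<open>mono\<close>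
  means increasing in every coordinate).  The first four conjuncts only say that
  \<open>U\<close> and \<open>V\<close> are random vectors, on possibly different probability spaces.\<close>

definition stoch_le ::
  "'a measure \<Rightarrow> ('a \<Rightarrow> nat \<Rightarrow> real) \<Rightarrow> 'b measure \<Rightarrow> ('b \<Rightarrow> nat \<Rightarrow> real) \<Rightarrow> bool" where
  "stoch_le M U N V \<longleftrightarrow>
     prob_space M \<and> U \<in> borel_measurable M \<and>
     prob_space N \<and> V \<in> borel_measurable N \<and>
     (\<forall>f :: (nat \<Rightarrow> real) \<Rightarrow> real.
        f \<in> borel_measurable borel \<longrightarrow> bounded (range f) \<longrightarrow> mono f \<longrightarrow>
        prob_space.expectation M (\<lambda>\<omega>. f (U \<omega>)) \<le> prob_space.expectation N (\<lambda>\<omega>. f (V \<omega>)))"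

end

theory Submission
  imports Defs
begin

text \<open>
  The process \<open>|W|\<close> is a Markov chain on \<open>[0, \<infinity>)\<close>. Under drift \<open>\<mu>\<close>, reversing all signs of the
  first \<open>n\<close> steps changes the law of the path by the factor \<open>exp (-2 \<mu> W\<^sub>n)\<close>
  (\<open>nn_integral_walk_upto_uminus\<close>). Hence, given \<open>|W\<^sub>1|, \<dots>, |W\<^sub>n|\<close> with \<open>|W\<^sub>n| = x\<close>, the sign of
  \<open>W\<^sub>n\<close> is positive with probability \<open>exp (\<mu> x) / (2 cosh (\<mu> x))\<close>, and averaging the normal
  step over this sign gives the transition density
  \<open>k z = cosh (\<mu> z) cosh (x z) \<phi>(z) / (exp ((x\<^sup>2 + \<mu>\<^sup>2) / 2) cosh (\<mu> x))\<close>,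
  where \<open>\<phi>\<close> is the standard normal density and the next state is \<open>|z|\<close>
  (\<open>nn_integral_abs_walk_upto_Suc\<close>).

  The kernel is symmetric in \<open>\<mu>\<close> and \<open>x\<close>. So a single likelihood-ratio argument
  (\<open>nn_integral_fold_kernel_mono\<close>), resting on the fact that \<open>cosh (x' z) / cosh (x z)\<close> increases
  in \<open>|z|\<close> when \<open>0 \<le> x \<le> x'\<close>, shows that the transition is stochastically increasing both in the
  current state and in \<open>|\<mu>|\<close>. Induction on \<open>n\<close> then compares the laws of the first \<open>n\<close> coordinates
  (\<open>nn_integral_abs_walk_upto_mono\<close>).

  The passage to infinitely many coordinates cannot go through densities, because the laws for
  distinct \<open>|\<mu>|\<close> are mutually singular. Instead, an upper set \<open>A\<close> is approximated from inside by a
  compact \<open>K\<close>. The sets of sequences that dominate some point of \<open>K\<close> in the coordinates up to \<open>n\<close>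
  depend on finitely many coordinates, and by compactness they decrease to the set of sequences that
  dominate some point of \<open>K\<close>, which lies in \<open>A\<close> (\<open>emeasure_upper_set_mono\<close>). Integrals of
  increasing functions reduce to upper sets by the layer-cake formula.
\<close>

section \<open>Truncated paths\<close>

text \<open>Zeros after time \<open>n\<close> let paths of all lengths live in the one space of sequences, so that
  statements about finitely many steps can be proved by induction on \<open>n\<close>.\<close>
definition walk_upto :: "(nat \<Rightarrow> 'a \<Rightarrow> real) \<Rightarrow> nat \<Rightarrow> 'a \<Rightarrow> nat \<Rightarrow> real" where
  "walk_upto Z n \<omega> = (\<lambda>i. if i \<le> n then walk Z i \<omega> else 0)"

definition abs_seq :: "(nat \<Rightarrow> real) \<Rightarrow> nat \<Rightarrow> real" where
  "abs_seq x = (\<lambda>i. \<bar>x i\<bar>)"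

lemma borel_measurable_coordinate [measurable]:
  "(\<lambda>x::nat \<Rightarrow> real. x i) \<in> borel_measurable borel"
  by (rule measurable_product_then_coordinatewise) simp

lemma borel_measurable_fun_upd [measurable]:
  fixes f :: "'a \<Rightarrow> nat \<Rightarrow> real"
  assumes f: "f \<in> borel_measurable M" and g: "g \<in> borel_measurable M"
  shows "(\<lambda>\<omega>. (f \<omega>)(k := g \<omega>)) \<in> borel_measurable M"
proof (rule measurable_coordinatewise_then_product)
  fix i show "(\<lambda>\<omega>. ((f \<omega>)(k := g \<omega>)) i) \<in> borel_measurable M"
    using g measurable_product_then_coordinatewise[OF f, of i] by (cases "i = k") simp_all
qed

lemma borel_measurable_abs_seq [measurable]: "abs_seq \<in> borel_measurable borel"
  unfolding abs_seq_def by (rule measurable_coordinatewise_then_product) measurable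

lemma borel_measurable_uminus_seq [measurable]:
  "(\<lambda>x i. - x i) \<in> borel_measurable (borel :: (nat \<Rightarrow> real) measure)"
  by (rule measurable_coordinatewise_then_product) measurable

lemma walk_Suc: "walk Z (Suc n) \<omega> = walk Z n \<omega> + Z (Suc n) \<omega>"
  by (simp add: walk_def)

lemma walk_upto_0: "walk_upto Z 0 \<omega> = (\<lambda>_. 0)"
  by (auto simp: walk_upto_def walk_def)

lemma walk_upto_Suc: "walk_upto Z (Suc n) \<omega> = (walk_upto Z n \<omega>)(Suc n := walk_upto Z n \<omega> n + Z (Suc n) \<omega>)"
  by (auto simp: walk_upto_def walk_Suc le_Suc_eq)

lemma borel_measurable_normal_step:
  assumes "normal_steps M \<mu> Z" "1 \<le> n"
  shows "Z n \<in> borel_measurable M"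
proof -
  have "distributed M lborel (Z n) (normal_density \<mu> 1)"
    using assms by (simp add: normal_steps_def)
  from distributed_measurable[OF this] show ?thesis by simp
qed

lemma borel_measurable_walk:
  assumes "normal_steps M \<mu> Z"
  shows "walk Z n \<in> borel_measurable M"
  unfolding walk_def[abs_def] using borel_measurable_normal_step[OF assms] by auto

lemma borel_measurable_walk_upto:
  assumes "normal_steps M \<mu> Z"
  shows "walk_upto Z n \<in> borel_measurable M"
proof (rule measurable_coordinatewise_then_product)
  fix i show "(\<lambda>\<omega>. walk_upto Z n \<omega> i) \<in> borel_measurable M"
    using borel_measurable_walk[OF assms, of i] by (cases "i \<le> n") (simp_all add: walk_upto_def)
qed

section \<open>The transition kernel of the absolute walk\<close>

text \<open>The density is symmetric on the whole line: the next state of the absolute walk is \<open>|z|\<close>.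
  Keeping \<open>z\<close> on the line avoids integrals over a half line.\<close>
definition fold_kernel :: "real \<Rightarrow> real \<Rightarrow> real \<Rightarrow> real" where
  "fold_kernel \<mu> x z =
     cosh (\<mu> * z) * cosh (x * z) * std_normal_density z / (exp ((x\<^sup>2 + \<mu>\<^sup>2) / 2) * cosh (\<mu> * x))"

text \<open>Exponential tilting: changing the mean multiplies the density by an exponential.\<close>
lemma normal_density_unit:
  "normal_density m 1 z = std_normal_density z * exp (m * z - m\<^sup>2 / 2)"
proof -
  have "- (z - m)\<^sup>2 / 2 = - z\<^sup>2 / 2 + (m * z - m\<^sup>2 / 2)"
    by (simp add: power2_eq_square field_simps)
  then have "exp (- (z - m)\<^sup>2 / 2) = exp (- z\<^sup>2 / 2) * exp (m * z - m\<^sup>2 / 2)"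
    by (simp only: exp_add)
  then show ?thesis
    by (simp add: normal_density_def)
qed

lemma fold_kernel_nonneg [simp]: "0 \<le> fold_kernel \<mu> x z"
  by (simp add: fold_kernel_def)

lemma fold_kernel_pos: "0 < fold_kernel \<mu> x z"
  by (simp add: fold_kernel_def normal_density_pos)

lemma borel_measurable_fold_kernel [measurable]:
  assumes [measurable]: "f \<in> borel_measurable M" "g \<in> borel_measurable M"
  shows "(\<lambda>\<omega>. fold_kernel \<mu> (f \<omega>) (g \<omega>)) \<in> borel_measurable M"
  unfolding fold_kernel_def cosh_field_def by measurable

lemma fold_kernel_commute: "fold_kernel \<mu> x z = fold_kernel x \<mu> z"
  by (simp add: fold_kernel_def ac_simps)

lemma fold_kernel_abs: "fold_kernel \<bar>\<mu>\<bar> x z = fold_kernel \<mu> x z"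
  by (cases "0 \<le> \<mu>") (simp_all add: fold_kernel_def)

lemma cosh_mult_cosh: "4 * (cosh a * cosh b) = exp (a + b) + exp (- (a + b)) + exp (a - b) + exp (b - a)" for a b :: real
  by (simp add: cosh_field_def field_simps exp_add[symmetric])

text \<open>Averaging the normal densities centred at \<open>x + \<mu>\<close> and \<open>\<mu> - x\<close> with the sign weights
  \<open>exp (\<plusminus> \<mu> x) / (2 cosh (\<mu> x))\<close>, and then over \<open>\<plusminus> z\<close>, gives the kernel; the square in each exponent
  is completed to factor out \<open>exp (- (x\<^sup>2 + \<mu>\<^sup>2) / 2)\<close>.\<close>
lemma fold_kernel_eq:
  "fold_kernel \<mu> x z =
     (exp (\<mu> * x) * (normal_density (x + \<mu>) 1 z + normal_density (x + \<mu>) 1 (- z)) +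
      exp (- (\<mu> * x)) * (normal_density (\<mu> - x) 1 z + normal_density (\<mu> - x) 1 (- z))) / (4 * cosh (\<mu> * x))"
proof -
  let ?e = "exp (- ((x\<^sup>2 + \<mu>\<^sup>2) / 2))"
  have 1: "exp (\<mu> * x) * normal_density (x + \<mu>) 1 y = std_normal_density y * ?e * exp (x * y + \<mu> * y)" for y
  proof -
    have "\<mu> * x + ((x + \<mu>) * y - (x + \<mu>)\<^sup>2 / 2) = - ((x\<^sup>2 + \<mu>\<^sup>2) / 2) + (x * y + \<mu> * y)"
      by (simp add: power2_eq_square field_simps)
    then have "exp (\<mu> * x) * exp ((x + \<mu>) * y - (x + \<mu>)\<^sup>2 / 2) = ?e * exp (x * y + \<mu> * y)"
      unfolding exp_add[symmetric] by simp
    then show ?thesis unfolding normal_density_unit[of "x + \<mu>"] by simp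
  qed
  have 2: "exp (- (\<mu> * x)) * normal_density (\<mu> - x) 1 y = std_normal_density y * ?e * exp (\<mu> * y - x * y)" for y
  proof -
    have "- (\<mu> * x) + ((\<mu> - x) * y - (\<mu> - x)\<^sup>2 / 2) = - ((x\<^sup>2 + \<mu>\<^sup>2) / 2) + (\<mu> * y - x * y)"
      by (simp add: power2_eq_square field_simps)
    then have "exp (- (\<mu> * x)) * exp ((\<mu> - x) * y - (\<mu> - x)\<^sup>2 / 2) = ?e * exp (\<mu> * y - x * y)"
      unfolding exp_add[symmetric] by simp
    then show ?thesis unfolding normal_density_unit[of "\<mu> - x"] by simp
  qed
  have even: "std_normal_density (- z) = std_normal_density z"
    by (simp add: normal_density_def)
  have "exp (\<mu> * x) * (normal_density (x + \<mu>) 1 z + normal_density (x + \<mu>) 1 (- z)) +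
      exp (- (\<mu> * x)) * (normal_density (\<mu> - x) 1 z + normal_density (\<mu> - x) 1 (- z))
    = std_normal_density z * ?e * (4 * (cosh (\<mu> * z) * cosh (x * z)))"
  proof -
    have args: "x * - z + \<mu> * - z = - (\<mu> * z + x * z)" "x * z + \<mu> * z = \<mu> * z + x * z"
      "\<mu> * - z - x * - z = x * z - \<mu> * z"
      by simp_all
    show ?thesis
      unfolding distrib_left[of "exp (\<mu> * x)"] distrib_left[of "exp (- (\<mu> * x))"] 1 2 even args cosh_mult_cosh
      by (simp only: distrib_left add.assoc)
  qed
  moreover have "a * b * p / (e * c) = p * inverse e * (4 * (a * b)) / (4 * c)" for a b c e p :: real
    by (cases "e = 0"; cases "c = 0"; simp add: field_simps)
  ultimately show ?thesis
    unfolding fold_kernel_def by (simp only: exp_minus)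
qed

lemma nn_integral_uminus:
  fixes f :: "real \<Rightarrow> ennreal"
  assumes [measurable]: "f \<in> borel_measurable borel"
  shows "(\<integral>\<^sup>+z. f (- z) \<partial>lborel) = (\<integral>\<^sup>+z. f z \<partial>lborel)"
  using nn_integral_real_affine[OF assms, of "-1" 0] by simp

lemma nn_integral_normal_density: "(\<integral>\<^sup>+z. ennreal (normal_density m 1 z) \<partial>lborel) = 1"
proof -
  interpret prob_space "density lborel (normal_density m 1)"
    by (rule prob_space_normal_density) simp
  show ?thesis using emeasure_space_1 by (simp add: emeasure_density)
qed

text \<open>An even integrand does not distinguish \<open>z\<close> from \<open>- z\<close>, so only the average over the sign of the
  current position remains. In this form the kernel appears in the Markov property.\<close>
lemma nn_integral_fold_kernel_even:
  fixes H :: "real \<Rightarrow> ennreal"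
  assumes [measurable]: "H \<in> borel_measurable borel" and even: "\<And>z. H (- z) = H z"
  shows "(\<integral>\<^sup>+z. ennreal (fold_kernel \<mu> x z) * H z \<partial>lborel) =
    ennreal (exp (\<mu> * x) / (2 * cosh (\<mu> * x))) * (\<integral>\<^sup>+z. ennreal (normal_density (x + \<mu>) 1 z) * H z \<partial>lborel)
  + ennreal (exp (- (\<mu> * x)) / (2 * cosh (\<mu> * x))) * (\<integral>\<^sup>+z. ennreal (normal_density (\<mu> - x) 1 z) * H z \<partial>lborel)"
proof -
  let ?I = "\<lambda>m. \<integral>\<^sup>+z. ennreal (normal_density m 1 z) * H z \<partial>lborel"
  let ?a = "exp (\<mu> * x) / (2 * cosh (\<mu> * x))" and ?b = "exp (- (\<mu> * x)) / (2 * cosh (\<mu> * x))"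
  have flip: "(\<integral>\<^sup>+z. ennreal (normal_density m 1 (- z)) * H z \<partial>lborel) = ?I m" for m
    using nn_integral_uminus[of "\<lambda>z. ennreal (normal_density m 1 z) * H z"] by (simp add: even)
  have half: "ennreal (c / 2) * t + ennreal (c / 2) * t = ennreal c * t" if "0 \<le> c" for c t
    using that by (simp add: distrib_right[symmetric] ennreal_plus[symmetric] del: ennreal_plus)
  have k: "fold_kernel \<mu> x z =
      (?a / 2 * normal_density (x + \<mu>) 1 z + ?a / 2 * normal_density (x + \<mu>) 1 (- z)) +
      (?b / 2 * normal_density (\<mu> - x) 1 z + ?b / 2 * normal_density (\<mu> - x) 1 (- z))" for z
    unfolding fold_kernel_eq by (simp add: add_divide_distrib distrib_left)
  have "(\<integral>\<^sup>+z. ennreal (fold_kernel \<mu> x z) * H z \<partial>lborel) =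
    (\<integral>\<^sup>+z. (ennreal (?a / 2) * (ennreal (normal_density (x + \<mu>) 1 z) * H z) +
          ennreal (?a / 2) * (ennreal (normal_density (x + \<mu>) 1 (- z)) * H z)) +
         (ennreal (?b / 2) * (ennreal (normal_density (\<mu> - x) 1 z) * H z) +
          ennreal (?b / 2) * (ennreal (normal_density (\<mu> - x) 1 (- z)) * H z)) \<partial>lborel)"
    unfolding k
    by (intro nn_integral_cong, subst ennreal_plus, simp, simp, (subst ennreal_plus, simp, simp)+)
       (simp only: ennreal_mult' divide_nonneg_nonneg exp_ge_zero cosh_real_nonneg mult_nonneg_nonneg zero_le_numeral distrib_right mult.assoc)
  also have "\<dots> = (ennreal (?a / 2) * ?I (x + \<mu>) + ennreal (?a / 2) * ?I (x + \<mu>)) +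
      (ennreal (?b / 2) * ?I (\<mu> - x) + ennreal (?b / 2) * ?I (\<mu> - x))"
    by (simp add: nn_integral_add nn_integral_cmult flip del: times_divide_eq_right)
  also have "\<dots> = ennreal ?a * ?I (x + \<mu>) + ennreal ?b * ?I (\<mu> - x)"
    by (subst half, simp, subst half, simp, rule refl)
  finally show ?thesis .
qed

text \<open>The two sign weights add up to 1.\<close>
lemma nn_integral_fold_kernel: "(\<integral>\<^sup>+z. ennreal (fold_kernel \<mu> x z) \<partial>lborel) = 1"
proof -
  have "exp (\<mu> * x) / (2 * cosh (\<mu> * x)) + exp (- (\<mu> * x)) / (2 * cosh (\<mu> * x)) = 1"
    by (simp add: cosh_field_def field_simps add_nonneg_eq_0_iff)
  then show ?thesis
    using nn_integral_fold_kernel_even[of "\<lambda>_. 1" \<mu> x]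
    by (simp add: nn_integral_normal_density ennreal_plus[symmetric] del: ennreal_plus)
qed

section \<open>Likelihood ratios\<close>

text \<open>Monotone likelihood ratio of \<open>cosh (x \<cdot>)\<close> in \<open>x\<close>. The product formula turns both sides into
  sums of two hyperbolic cosines, which are then compared argument by argument.\<close>
lemma cosh_ratio:
  fixes x x' y z :: real
  assumes "0 \<le> x" "x \<le> x'" "\<bar>y\<bar> \<le> \<bar>z\<bar>"
  shows "cosh (x' * y) * cosh (x * z) \<le> cosh (x' * z) * cosh (x * y)"
proof -
  have prod: "2 * (cosh a * cosh b) = cosh (a + b) + cosh (a - b)" for a b :: real
    by (simp add: cosh_add cosh_diff)
  have le: "cosh a \<le> cosh b" if "\<bar>a\<bar> \<le> \<bar>b\<bar>" for a b :: real
    using that cosh_real_nonneg_le_iff[of "\<bar>a\<bar>" "\<bar>b\<bar>"] by simp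
  have cabs: "cosh (c * \<bar>t\<bar>) = cosh (c * t)" for c t :: real
    by (cases "0 \<le> t") simp_all
  have *: "(x' - x) * (\<bar>z\<bar> - \<bar>y\<bar>) \<ge> 0" "(x' + x) * (\<bar>z\<bar> - \<bar>y\<bar>) \<ge> 0"
      "(x' - x) * (\<bar>z\<bar> + \<bar>y\<bar>) \<ge> 0" "0 \<le> x * \<bar>y\<bar>" "0 \<le> x * \<bar>z\<bar>" "0 \<le> x' * \<bar>y\<bar>" "0 \<le> x' * \<bar>z\<bar>"
    using assms by simp_all
  have "cosh (x' * \<bar>y\<bar> + x * \<bar>z\<bar>) \<le> cosh (x' * \<bar>z\<bar> + x * \<bar>y\<bar>)"
    using * by (intro le) (simp add: algebra_simps)
  moreover have "cosh (x' * \<bar>y\<bar> - x * \<bar>z\<bar>) \<le> cosh (x' * \<bar>z\<bar> - x * \<bar>y\<bar>)"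
  proof (rule le)
    have "\<bar>x' * \<bar>y\<bar> - x * \<bar>z\<bar>\<bar> \<le> x' * \<bar>z\<bar> - x * \<bar>y\<bar>"
      using * unfolding abs_le_iff by (simp add: algebra_simps)
    then show "\<bar>x' * \<bar>y\<bar> - x * \<bar>z\<bar>\<bar> \<le> \<bar>x' * \<bar>z\<bar> - x * \<bar>y\<bar>\<bar>" by linarith
  qed
  ultimately have "2 * (cosh (x' * \<bar>y\<bar>) * cosh (x * \<bar>z\<bar>)) \<le> 2 * (cosh (x' * \<bar>z\<bar>) * cosh (x * \<bar>y\<bar>))"
    unfolding prod by linarith
  then show ?thesis by (simp add: cabs)
qed

text \<open>The likelihood ratio \<open>b / a\<close> increases in \<open>r\<close>, so \<open>b - a\<close> changes sign once: \<open>h\<close> is at most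
  some constant \<open>c\<close> where \<open>b < a\<close> and at least \<open>c\<close> elsewhere. Hence \<open>(h - c) (b - a) \<ge> 0\<close>, and the
  constant contributes nothing since both densities have total mass 1. Subtraction is avoided
  throughout, because \<open>h\<close> takes values in the extended nonnegative reals.\<close>
lemma nn_integral_mono_likelihood_ratio:
  fixes a b :: "'a \<Rightarrow> real" and h :: "'a \<Rightarrow> ennreal" and r :: "'a \<Rightarrow> real"
  assumes [measurable]: "a \<in> borel_measurable M" "b \<in> borel_measurable M" "h \<in> borel_measurable M"
    and a: "\<And>z. 0 < a z" and b: "\<And>z. 0 < b z"
    and total: "(\<integral>\<^sup>+z. a z \<partial>M) = 1" "(\<integral>\<^sup>+z. b z \<partial>M) = 1"
    and ratio: "\<And>y z. r y \<le> r z \<Longrightarrow> b y * a z \<le> b z * a y"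
    and h: "\<And>y z. r y \<le> r z \<Longrightarrow> h y \<le> h z" and h1: "\<And>z. h z \<le> 1"
  shows "(\<integral>\<^sup>+z. a z * h z \<partial>M) \<le> (\<integral>\<^sup>+z. b z * h z \<partial>M)"
proof -
  \<comment> \<open>If \<open>b < a\<close> holds nowhere, this supremum is 0, which is still below every value of \<open>h\<close>.\<close>
  define c where "c = (SUP z\<in>{z. b z < a z}. h z)"
  have c1: "c \<le> 1" unfolding c_def by (rule SUP_least) (rule h1)
  have below: "h z \<le> c" if "b z < a z" for z
    unfolding c_def using that by (intro SUP_upper) simp
  have above: "c \<le> h z" if z: "\<not> b z < a z" for z
    unfolding c_def
  proof (rule SUP_least)
    fix y assume "y \<in> {z. b z < a z}"
    then have y: "b y < a y" by simp
    have "\<not> r z \<le> r y"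
    proof
      assume "r z \<le> r y"
      then have "b z * a y \<le> b y * a z" by (rule ratio)
      also have "\<dots> < a y * a z" using y a[of z] by simp
      finally show False using z a[of y] by simp
    qed
    then show "h y \<le> h z" using h by simp
  qed
  have swap: "ennreal s * u + ennreal t * v \<le> ennreal t * u + ennreal s * v"
    if "0 \<le> t" "t \<le> s" "u \<le> v" for s t :: real and u v :: ennreal
  proof -
    define d where "d = s - t"
    have d: "s = t + d" "0 \<le> d" using that by (simp_all add: d_def)
    have "ennreal d * u \<le> ennreal d * v" using that by (intro mult_left_mono) auto
    then have "(ennreal t * u + ennreal t * v) + ennreal d * u \<le> (ennreal t * u + ennreal t * v) + ennreal d * v"
      by (rule add_left_mono)
    moreover have e: "ennreal s = ennreal t + ennreal d" using d that by simp
    ultimately show ?thesis unfolding e distrib_right by (simp only: ac_simps)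
  qed
  have pw: "a z * h z + b z * c \<le> b z * h z + a z * c" for z
  proof (cases "b z < a z")
    case True
    then show ?thesis using swap[of "b z" "a z" "h z" c] below[of z] b[of z] by simp
  next
    case False
    then show ?thesis using swap[of "a z" "b z" c "h z"] above[of z] a[of z]
      by (simp add: add.commute)
  qed
  have "(\<integral>\<^sup>+z. a z * h z \<partial>M) + c = (\<integral>\<^sup>+z. a z * h z + b z * c \<partial>M)"
    by (simp add: nn_integral_add nn_integral_multc total)
  also have "\<dots> \<le> (\<integral>\<^sup>+z. b z * h z + a z * c \<partial>M)"
    by (rule nn_integral_mono) (rule pw)
  also have "\<dots> = (\<integral>\<^sup>+z. b z * h z \<partial>M) + c"
    by (simp add: nn_integral_add nn_integral_multc total)
  finally have "c + (\<integral>\<^sup>+z. a z * h z \<partial>M) \<le> c + (\<integral>\<^sup>+z. b z * h z \<partial>M)"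
    by (simp add: add.commute)
  moreover have "c \<noteq> \<top>" using c1 by (auto simp: top_unique)
  ultimately show ?thesis by (simp add: ennreal_add_left_cancel_le)
qed

text \<open>The ratio of the densities for \<open>x'\<close> and \<open>x\<close> is \<open>cosh (x' z) / cosh (x z)\<close> up to a factor free of \<open>z\<close>.\<close>
lemma nn_integral_fold_kernel_mono:
  fixes H :: "real \<Rightarrow> ennreal"
  assumes [measurable]: "H \<in> borel_measurable borel"
    and H: "\<And>y z. \<bar>y\<bar> \<le> \<bar>z\<bar> \<Longrightarrow> H y \<le> H z" "\<And>z. H z \<le> 1" and x: "0 \<le> x" "x \<le> x'"
  shows "(\<integral>\<^sup>+z. ennreal (fold_kernel \<mu> x z) * H z \<partial>lborel) \<le> (\<integral>\<^sup>+z. ennreal (fold_kernel \<mu> x' z) * H z \<partial>lborel)"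
proof (rule nn_integral_mono_likelihood_ratio[where r = abs])
  fix y z :: real assume "\<bar>y\<bar> \<le> \<bar>z\<bar>"
  then have "cosh (x' * y) * cosh (x * z) \<le> cosh (x' * z) * cosh (x * y)"
    using x by (intro cosh_ratio)
  then have "(cosh (\<mu> * y) * cosh (\<mu> * z) * std_normal_density y * std_normal_density z /
      (exp ((x\<^sup>2 + \<mu>\<^sup>2) / 2) * cosh (\<mu> * x) * (exp ((x'\<^sup>2 + \<mu>\<^sup>2) / 2) * cosh (\<mu> * x')))) *
      (cosh (x' * y) * cosh (x * z)) \<le> 
     (cosh (\<mu> * y) * cosh (\<mu> * z) * std_normal_density y * std_normal_density z /
      (exp ((x\<^sup>2 + \<mu>\<^sup>2) / 2) * cosh (\<mu> * x) * (exp ((x'\<^sup>2 + \<mu>\<^sup>2) / 2) * cosh (\<mu> * x')))) *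
      (cosh (x' * z) * cosh (x * y))"
    by (intro mult_left_mono) simp_all
  then show "fold_kernel \<mu> x' y * fold_kernel \<mu> x z \<le> fold_kernel \<mu> x' z * fold_kernel \<mu> x y"
    unfolding fold_kernel_def by (simp add: ac_simps)
next
  show "fold_kernel \<mu> x \<in> borel_measurable lborel" "fold_kernel \<mu> x' \<in> borel_measurable lborel"
    using borel_measurable_fold_kernel[of "\<lambda>_. x" lborel "\<lambda>z. z" \<mu>]
      borel_measurable_fold_kernel[of "\<lambda>_. x'" lborel "\<lambda>z. z" \<mu>] by simp_all
qed (use H in \<open>simp_all add: fold_kernel_pos nn_integral_fold_kernel\<close>)

section \<open>Monotonicity of one step\<close>

text \<open>The conditional expectation of \<open>F\<close> when coordinate \<open>Suc n\<close> is drawn by the kernel from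
  the state \<open>x n\<close>.\<close>
definition fold_step :: "real \<Rightarrow> nat \<Rightarrow> ((nat \<Rightarrow> real) \<Rightarrow> ennreal) \<Rightarrow> (nat \<Rightarrow> real) \<Rightarrow> ennreal" where
  "fold_step \<mu> n F x = (\<integral>\<^sup>+z. ennreal (fold_kernel \<mu> (x n) z) * F (x(Suc n := \<bar>z\<bar>)) \<partial>lborel)"

text \<open>The sequence \<open>x\<close> enters twice: as an argument of \<open>F\<close>, and through the starting state \<open>x n\<close> of the
  kernel. Only nonnegative sequences are compared, since the kernel is stochastically increasing in
  the absolute value of its starting state.\<close>
lemma fold_step_mono:
  assumes [measurable]: "F \<in> borel_measurable borel"
    and mono: "mono_on {x. \<forall>i. 0 \<le> x i} F" and F1: "\<And>x. F x \<le> 1"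
  shows "mono_on {x. \<forall>i. 0 \<le> x i} (fold_step \<mu> n F)"
proof (rule mono_onI)
  fix x y :: "nat \<Rightarrow> real"
  assume x: "x \<in> {x. \<forall>i. 0 \<le> x i}" and y: "y \<in> {x. \<forall>i. 0 \<le> x i}" and "x \<le> y"
  then have le: "x i \<le> y i" for i by (simp add: le_fun_def)
  have "fold_step \<mu> n F x \<le> (\<integral>\<^sup>+z. ennreal (fold_kernel \<mu> (x n) z) * F (y(Suc n := \<bar>z\<bar>)) \<partial>lborel)"
    unfolding fold_step_def using x y le
    by (intro nn_integral_mono mult_left_mono mono_onD[OF mono]) (auto simp: le_fun_def)
  also have "\<dots> \<le> fold_step \<mu> n F y"
    unfolding fold_step_def using x y le F1
    by (intro nn_integral_fold_kernel_mono mono_onD[OF mono]) (auto simp: le_fun_def)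
  finally show "fold_step \<mu> n F x \<le> fold_step \<mu> n F y" .
qed

text \<open>By the symmetry of the kernel this is monotonicity in the starting state with \<open>|\<mu>|\<close> and \<open>|\<nu>|\<close>
  as the states.\<close>
lemma fold_step_mono_drift:
  assumes [measurable]: "F \<in> borel_measurable borel"
    and mono: "mono_on {x. \<forall>i. 0 \<le> x i} F" and F1: "\<And>x. F x \<le> 1"
    and x: "\<forall>i. 0 \<le> x i" and drift: "\<bar>\<mu>\<bar> \<le> \<bar>\<nu>\<bar>"
  shows "fold_step \<mu> n F x \<le> fold_step \<nu> n F x"
proof -
  have "(\<integral>\<^sup>+z. ennreal (fold_kernel (x n) \<bar>\<mu>\<bar> z) * F (x(Suc n := \<bar>z\<bar>)) \<partial>lborel)
     \<le> (\<integral>\<^sup>+z. ennreal (fold_kernel (x n) \<bar>\<nu>\<bar> z) * F (x(Suc n := \<bar>z\<bar>)) \<partial>lborel)"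
    using x drift F1
    by (intro nn_integral_fold_kernel_mono mono_onD[OF mono]) (auto simp: le_fun_def)
  then show ?thesis
    unfolding fold_step_def by (simp add: fold_kernel_commute[of "x n"] fold_kernel_abs)
qed

lemma fold_step_le_1:
  assumes F1: "\<And>x. F x \<le> 1"
  shows "fold_step \<mu> n F x \<le> 1"
proof -
  have "fold_step \<mu> n F x \<le> (\<integral>\<^sup>+z. ennreal (fold_kernel \<mu> (x n) z) * 1 \<partial>lborel)"
    unfolding fold_step_def using F1 by (intro nn_integral_mono mult_left_mono) auto
  then show ?thesis by (simp add: nn_integral_fold_kernel)
qed

lemma borel_measurable_fold_step [measurable]:
  assumes [measurable]: "F \<in> borel_measurable borel"
  shows "fold_step \<mu> n F \<in> borel_measurable borel"
  unfolding fold_step_def[abs_def] by measurable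

section \<open>The absolute walk as a Markov chain\<close>

lemma nn_integral_walk_upto_Suc:
  fixes g :: "(nat \<Rightarrow> real) \<Rightarrow> ennreal"
  assumes N: "normal_steps M \<mu> Z" and [measurable]: "g \<in> borel_measurable borel"
  shows "(\<integral>\<^sup>+\<omega>. g (walk_upto Z (Suc n) \<omega>) \<partial>M) =
    (\<integral>\<^sup>+\<omega>. (\<integral>\<^sup>+z. ennreal (normal_density \<mu> 1 z) * g ((walk_upto Z n \<omega>)(Suc n := walk_upto Z n \<omega> n + z)) \<partial>lborel) \<partial>M)"
proof -
  interpret prob_space M using N by (simp add: normal_steps_def)
  note [measurable] = borel_measurable_walk_upto[OF N]
  have Z: "distributed M lborel (Z (Suc n)) (normal_density \<mu> 1)"
    using N by (simp add: normal_steps_def)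
  have [measurable]: "Z (Suc n) \<in> borel_measurable M"
    using borel_measurable_normal_step[OF N] by simp
  \<comment> \<open>The predicate \<open>indep_var\<close> relates variables with values in one type, so the next step is
     encoded as a constant sequence.\<close>
  define V :: "_ \<Rightarrow> nat \<Rightarrow> real" where "V = (\<lambda>\<omega> _. Z (Suc n) \<omega>)"
  have [measurable]: "V \<in> borel_measurable M"
    unfolding V_def by (rule measurable_coordinatewise_then_product) simp
  define R :: "(nat \<Rightarrow> real) \<Rightarrow> nat \<Rightarrow> real" where "R = (\<lambda>r i. if i \<le> n then \<Sum>j=1..i. r j else 0)"
  have R: "R \<in> borel_measurable (Pi\<^sub>M {1..n} (\<lambda>_. borel))"
  proof (rule measurable_coordinatewise_then_product)
    fix i show "(\<lambda>r. R r i) \<in> borel_measurable (Pi\<^sub>M {1..n} (\<lambda>_. borel))"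
      unfolding R_def by (cases "i \<le> n") (auto intro!: borel_measurable_sum measurable_component_singleton)
  qed
  have "indep_var (Pi\<^sub>M {1..n} (\<lambda>_. borel)) (\<lambda>\<omega>. restrict (\<lambda>i. Z i \<omega>) {1..n})
      (Pi\<^sub>M {Suc n} (\<lambda>_. borel)) (\<lambda>\<omega>. restrict (\<lambda>i. Z i \<omega>) {Suc n})"
    by (rule indep_var_restrict[where I = "{1..}"]) (use N in \<open>auto simp: normal_steps_def\<close>)
  then have "indep_var borel (R \<circ> (\<lambda>\<omega>. restrict (\<lambda>i. Z i \<omega>) {1..n}))
      borel ((\<lambda>r _. r (Suc n)) \<circ> (\<lambda>\<omega>. restrict (\<lambda>i. Z i \<omega>) {Suc n}))"
  proof (rule indep_var_compose[OF _ R])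
    show "(\<lambda>r (_::nat). r (Suc n) :: real) \<in> Pi\<^sub>M {Suc n} (\<lambda>_. borel) \<rightarrow>\<^sub>M borel"
      by (rule measurable_coordinatewise_then_product) (simp add: measurable_component_singleton)
  qed
  also have "R \<circ> (\<lambda>\<omega>. restrict (\<lambda>i. Z i \<omega>) {1..n}) = walk_upto Z n"
    by (auto simp: fun_eq_iff R_def walk_upto_def walk_def intro!: sum.cong)
  also have "(\<lambda>r _. r (Suc n)) \<circ> (\<lambda>\<omega>. restrict (\<lambda>i. Z i \<omega>) {Suc n}) = V"
    by (auto simp: V_def)
  finally have indep: "distr M borel (walk_upto Z n) \<Otimes>\<^sub>M distr M borel V =
      distr M (borel \<Otimes>\<^sub>M borel) (\<lambda>\<omega>. (walk_upto Z n \<omega>, V \<omega>))"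
    by (simp add: indep_var_distribution_eq)
  interpret Y: prob_space "distr M borel V" by (rule prob_space_distr) simp
  define G where "G = (\<lambda>(x::nat \<Rightarrow> real, y::nat \<Rightarrow> real). g (x(Suc n := x n + y 0)))"
  have G[measurable]: "G \<in> borel_measurable (borel \<Otimes>\<^sub>M borel)"
    unfolding G_def by measurable
  have G': "G \<in> borel_measurable (distr M borel (walk_upto Z n) \<Otimes>\<^sub>M distr M borel V)"
    unfolding indep by simp
  have "(\<integral>\<^sup>+\<omega>. g (walk_upto Z (Suc n) \<omega>) \<partial>M) = (\<integral>\<^sup>+\<omega>. G (walk_upto Z n \<omega>, V \<omega>) \<partial>M)"
    by (simp add: G_def V_def walk_upto_Suc)
  also have "\<dots> = (\<integral>\<^sup>+p. G p \<partial>(distr M borel (walk_upto Z n) \<Otimes>\<^sub>M distr M borel V))"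
    unfolding indep by (subst nn_integral_distr) simp_all
  also have "\<dots> = (\<integral>\<^sup>+x. (\<integral>\<^sup>+y. G (x, y) \<partial>distr M borel V) \<partial>distr M borel (walk_upto Z n))"
    by (rule Y.nn_integral_fst[OF G', symmetric])
  also have "\<dots> = (\<integral>\<^sup>+x. (\<integral>\<^sup>+z. ennreal (normal_density \<mu> 1 z) * g (x(Suc n := x n + z)) \<partial>lborel) \<partial>distr M borel (walk_upto Z n))"
  proof (intro nn_integral_cong)
    fix x
    have "(\<integral>\<^sup>+y. G (x, y) \<partial>distr M borel V) = (\<integral>\<^sup>+\<omega>. G (x, V \<omega>) \<partial>M)"
      by (subst nn_integral_distr) simp_all
    also have "\<dots> = (\<integral>\<^sup>+\<omega>. g (x(Suc n := x n + Z (Suc n) \<omega>)) \<partial>M)"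
      by (simp add: G_def V_def)
    also have "\<dots> = (\<integral>\<^sup>+z. ennreal (normal_density \<mu> 1 z) * g (x(Suc n := x n + z)) \<partial>lborel)"
      by (rule distributed_nn_integral[OF Z, symmetric]) simp
    finally show "(\<integral>\<^sup>+y. G (x, y) \<partial>distr M borel V) = (\<integral>\<^sup>+z. ennreal (normal_density \<mu> 1 z) * g (x(Suc n := x n + z)) \<partial>lborel)" .
  qed
  also have "\<dots> = (\<integral>\<^sup>+\<omega>. (\<integral>\<^sup>+z. ennreal (normal_density \<mu> 1 z) * g ((walk_upto Z n \<omega>)(Suc n := walk_upto Z n \<omega> n + z)) \<partial>lborel) \<partial>M)"
    by (subst nn_integral_distr) simp_all
  finally show ?thesis .
qed

text \<open>Reversing one step of mean \<open>\<mu>\<close> multiplies its density at \<open>z\<close> by \<open>exp (-2 \<mu> z)\<close>, and these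
  factors multiply to the exponential of the endpoint.\<close>
lemma nn_integral_walk_upto_uminus:
  fixes g :: "(nat \<Rightarrow> real) \<Rightarrow> ennreal"
  assumes N: "normal_steps M \<mu> Z" and "g \<in> borel_measurable borel"
  shows "(\<integral>\<^sup>+\<omega>. g (\<lambda>i. - walk_upto Z n \<omega> i) \<partial>M) =
    (\<integral>\<^sup>+\<omega>. ennreal (exp (- 2 * \<mu> * walk_upto Z n \<omega> n)) * g (walk_upto Z n \<omega>) \<partial>M)"
  using assms(2)
proof (induction n arbitrary: g)
  case 0
  then show ?case by (simp add: walk_upto_0)
next
  case (Suc n)
  note [measurable] = Suc.prems borel_measurable_walk_upto[OF N]
  let ?p = "\<lambda>z. ennreal (normal_density \<mu> 1 z)"
  define G where "G = (\<lambda>x::nat \<Rightarrow> real. \<integral>\<^sup>+z. ?p z * g (x(Suc n := x n - z)) \<partial>lborel)"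
  have G[measurable]: "G \<in> borel_measurable borel" unfolding G_def by measurable
  \<comment> \<open>The integration variable is reflected, and the density absorbs the resulting factor.\<close>
  have tilt: "ennreal (exp (- 2 * \<mu> * w)) * G x = (\<integral>\<^sup>+z. ?p z * (ennreal (exp (- 2 * \<mu> * (w + z))) * g (x(Suc n := x n + z))) \<partial>lborel)"
    for w and x :: "nat \<Rightarrow> real"
  proof -
    have dens: "exp (- 2 * \<mu> * w) * normal_density \<mu> 1 (- z) = normal_density \<mu> 1 z * exp (- 2 * \<mu> * (w + z))" for z
    proof -
      have "- 2 * \<mu> * w + - (- z - \<mu>)\<^sup>2 / 2 = - (z - \<mu>)\<^sup>2 / 2 + - 2 * \<mu> * (w + z)"
        by (simp add: power2_eq_square field_simps)
      then have "exp (- 2 * \<mu> * w) * exp (- (- z - \<mu>)\<^sup>2 / 2) = exp (- (z - \<mu>)\<^sup>2 / 2) * exp (- 2 * \<mu> * (w + z))"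
        by (simp only: exp_add[symmetric])
      then show ?thesis by (simp add: normal_density_def)
    qed
    have "G x = (\<integral>\<^sup>+z. ?p (- z) * g (x(Suc n := x n + z)) \<partial>lborel)"
      unfolding G_def using nn_integral_uminus[of "\<lambda>z. ?p z * g (x(Suc n := x n - z))"] by simp
    then have "ennreal (exp (- 2 * \<mu> * w)) * G x = (\<integral>\<^sup>+z. ennreal (exp (- 2 * \<mu> * w)) * (?p (- z) * g (x(Suc n := x n + z))) \<partial>lborel)"
      by (simp add: nn_integral_cmult)
    also have "\<dots> = (\<integral>\<^sup>+z. ?p z * (ennreal (exp (- 2 * \<mu> * (w + z))) * g (x(Suc n := x n + z))) \<partial>lborel)"
      by (simp only: mult.assoc[symmetric] ennreal_mult[symmetric] normal_density_nonneg exp_ge_zero dens)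
    finally show ?thesis .
  qed
  have upd: "(\<lambda>i. - (x(Suc n := a)) i) = (\<lambda>i. - x i)(Suc n := - a)" for x :: "nat \<Rightarrow> real" and a
    by auto
  have "(\<integral>\<^sup>+\<omega>. g (\<lambda>i. - walk_upto Z (Suc n) \<omega> i) \<partial>M) = (\<integral>\<^sup>+\<omega>. G (\<lambda>i. - walk_upto Z n \<omega> i) \<partial>M)"
    using nn_integral_walk_upto_Suc[OF N, of "\<lambda>x. g (\<lambda>i. - x i)" n]
    unfolding upd by (simp add: G_def)
  also have "\<dots> = (\<integral>\<^sup>+\<omega>. ennreal (exp (- 2 * \<mu> * walk_upto Z n \<omega> n)) * G (walk_upto Z n \<omega>) \<partial>M)"
    by (rule Suc.IH) simp
  also have "\<dots> = (\<integral>\<^sup>+\<omega>. ennreal (exp (- 2 * \<mu> * walk_upto Z (Suc n) \<omega> (Suc n))) * g (walk_upto Z (Suc n) \<omega>) \<partial>M)"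
    unfolding tilt
    using nn_integral_walk_upto_Suc[OF N, of "\<lambda>x. ennreal (exp (- 2 * \<mu> * x (Suc n))) * g x" n] by simp
  finally show ?case .
qed

text \<open>The conditional law of the next absolute value depends on the sign of the current position. The
  reflection formula replaces it by its average over the two signs, which depends on absolute values
  only; this is the Markov property of the absolute walk.\<close>
lemma nn_integral_abs_walk_upto_Suc:
  fixes F :: "(nat \<Rightarrow> real) \<Rightarrow> ennreal"
  assumes N: "normal_steps M \<mu> Z" and [measurable]: "F \<in> borel_measurable borel"
  shows "(\<integral>\<^sup>+\<omega>. F (abs_seq (walk_upto Z (Suc n) \<omega>)) \<partial>M) = (\<integral>\<^sup>+\<omega>. fold_step \<mu> n F (abs_seq (walk_upto Z n \<omega>)) \<partial>M)"
proof -
  note [measurable] = borel_measurable_walk_upto[OF N]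
  define I where "I = (\<lambda>m x. \<integral>\<^sup>+z. ennreal (normal_density m 1 z) * F ((abs_seq x)(Suc n := \<bar>z\<bar>)) \<partial>lborel)"
  define p where "p = (\<lambda>w. ennreal (exp (\<mu> * w) / (2 * cosh (\<mu> * w))))"
  define G where "G = (\<lambda>x::nat \<Rightarrow> real. I (x n + \<mu>) x)"
  have p[measurable]: "p \<in> borel_measurable borel"
    unfolding p_def cosh_field_def by measurable
  have G[measurable]: "G \<in> borel_measurable borel"
    unfolding G_def I_def normal_density_def by measurable
  have abs_upd: "abs_seq (x(Suc n := a)) = (abs_seq x)(Suc n := \<bar>a\<bar>)" for x a
    by (auto simp: abs_seq_def)
  have abs_neg: "abs_seq (\<lambda>i. - x i) = abs_seq x" for x
    by (simp add: abs_seq_def)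
  have shift: "(\<integral>\<^sup>+z. ennreal (normal_density \<mu> 1 z) * F ((abs_seq x)(Suc n := \<bar>x n + z\<bar>)) \<partial>lborel) = G x" for x
  proof -
    have "G x = (\<integral>\<^sup>+z. ennreal (normal_density (x n + \<mu>) 1 (x n + 1 * z)) * F ((abs_seq x)(Suc n := \<bar>x n + 1 * z\<bar>)) \<partial>lborel)"
      unfolding G_def I_def
      by (subst nn_integral_real_affine[where c = 1 and t = "x n"]) simp_all
    then show ?thesis by (simp add: normal_density_def)
  qed
  \<comment> \<open>The two summands are the weights of the signs; the second one is in the form to which the
     reflection formula applies.\<close>
  have split: "G x = p (x n) * G x + ennreal (exp (- 2 * \<mu> * x n)) * (p (x n) * G x)" for x
  proof -
    have "exp (- 2 * \<mu> * w) * (exp (\<mu> * w) / (2 * cosh (\<mu> * w))) = exp (- (\<mu> * w)) / (2 * cosh (\<mu> * w))" for w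
      by (simp add: mult_exp_exp)
    moreover have "exp (\<mu> * w) / (2 * cosh (\<mu> * w)) + exp (- (\<mu> * w)) / (2 * cosh (\<mu> * w)) = 1" for w
      by (simp add: cosh_field_def field_simps add_nonneg_eq_0_iff)
    ultimately have "p w + ennreal (exp (- 2 * \<mu> * w)) * p w = 1" for w
      unfolding p_def by (simp add: ennreal_mult[symmetric] ennreal_plus[symmetric] del: ennreal_plus)
    from arg_cong[where f = "\<lambda>t. t * G x", OF this[of "x n"]] show ?thesis
      by (simp add: distrib_right mult.assoc)
  qed
  have "(\<integral>\<^sup>+\<omega>. F (abs_seq (walk_upto Z (Suc n) \<omega>)) \<partial>M) = (\<integral>\<^sup>+\<omega>. G (walk_upto Z n \<omega>) \<partial>M)"
    using nn_integral_walk_upto_Suc[OF N, of "\<lambda>x. F (abs_seq x)" n] unfolding abs_upd shift by simp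
  also have "\<dots> = (\<integral>\<^sup>+\<omega>. p (walk_upto Z n \<omega> n) * G (walk_upto Z n \<omega>) \<partial>M) +
      (\<integral>\<^sup>+\<omega>. ennreal (exp (- 2 * \<mu> * walk_upto Z n \<omega> n)) * (p (walk_upto Z n \<omega> n) * G (walk_upto Z n \<omega>)) \<partial>M)"
    by (subst split, subst nn_integral_add) simp_all
  also have "(\<integral>\<^sup>+\<omega>. ennreal (exp (- 2 * \<mu> * walk_upto Z n \<omega> n)) * (p (walk_upto Z n \<omega> n) * G (walk_upto Z n \<omega>)) \<partial>M) =
      (\<integral>\<^sup>+\<omega>. p (- walk_upto Z n \<omega> n) * G (\<lambda>i. - walk_upto Z n \<omega> i) \<partial>M)"
    using nn_integral_walk_upto_uminus[OF N, of "\<lambda>x. p (x n) * G x" n] by simp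
  also have "(\<integral>\<^sup>+\<omega>. p (walk_upto Z n \<omega> n) * G (walk_upto Z n \<omega>) \<partial>M) + \<dots> =
      (\<integral>\<^sup>+\<omega>. p (walk_upto Z n \<omega> n) * G (walk_upto Z n \<omega>) + p (- walk_upto Z n \<omega> n) * G (\<lambda>i. - walk_upto Z n \<omega> i) \<partial>M)"
    by (subst nn_integral_add) simp_all
  also have "\<dots> = (\<integral>\<^sup>+\<omega>. fold_step \<mu> n F (abs_seq (walk_upto Z n \<omega>)) \<partial>M)"
  proof (intro nn_integral_cong)
    fix \<omega>
    let ?x = "walk_upto Z n \<omega>"
    have "fold_step \<mu> n F (abs_seq ?x) =
        (\<integral>\<^sup>+z. ennreal (fold_kernel \<mu> (?x n) z) * F ((abs_seq ?x)(Suc n := \<bar>z\<bar>)) \<partial>lborel)"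
      unfolding fold_step_def
      by (simp add: abs_seq_def fold_kernel_commute[of \<mu>] fold_kernel_abs)
    also have "\<dots> = p (?x n) * I (?x n + \<mu>) ?x + p (- ?x n) * I (\<mu> - ?x n) ?x"
      unfolding I_def p_def by (subst nn_integral_fold_kernel_even) simp_all
    also have "\<dots> = p (?x n) * G ?x + p (- ?x n) * G (\<lambda>i. - ?x i)"
      unfolding G_def I_def abs_neg by simp
    finally show "p (?x n) * G ?x + p (- ?x n) * G (\<lambda>i. - ?x i) = fold_step \<mu> n F (abs_seq ?x)" ..
  qed
  finally show ?thesis .
qed

text \<open>The last step is peeled off: first the drift of that step is raised, which is monotone pointwise,
  and then the induction hypothesis is applied to the resulting function of the shorter path, which is
  again increasing and bounded by 1.\<close>
lemma nn_integral_abs_walk_upto_mono: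
  fixes F :: "(nat \<Rightarrow> real) \<Rightarrow> ennreal"
  assumes N: "normal_steps M \<mu> Z" and N': "normal_steps M' \<nu> Z'" and drift: "\<bar>\<mu>\<bar> \<le> \<bar>\<nu>\<bar>"
    and "F \<in> borel_measurable borel" "mono_on {x. \<forall>i. 0 \<le> x i} F" "\<And>x. F x \<le> 1"
  shows "(\<integral>\<^sup>+\<omega>. F (abs_seq (walk_upto Z n \<omega>)) \<partial>M) \<le> (\<integral>\<^sup>+\<omega>. F (abs_seq (walk_upto Z' n \<omega>)) \<partial>M')"
  using assms(4-)
proof (induction n arbitrary: F)
  case 0
  interpret M: prob_space M using N by (simp add: normal_steps_def)
  interpret M': prob_space M' using N' by (simp add: normal_steps_def)
  show ?case by (simp add: walk_upto_0 M.emeasure_space_1 M'.emeasure_space_1)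
next
  case (Suc n)
  note F = Suc.prems
  have "(\<integral>\<^sup>+\<omega>. F (abs_seq (walk_upto Z (Suc n) \<omega>)) \<partial>M) = (\<integral>\<^sup>+\<omega>. fold_step \<mu> n F (abs_seq (walk_upto Z n \<omega>)) \<partial>M)"
    by (rule nn_integral_abs_walk_upto_Suc[OF N F(1)])
  also have "\<dots> \<le> (\<integral>\<^sup>+\<omega>. fold_step \<nu> n F (abs_seq (walk_upto Z n \<omega>)) \<partial>M)"
    by (intro nn_integral_mono fold_step_mono_drift F drift) (simp add: abs_seq_def)
  also have "\<dots> \<le> (\<integral>\<^sup>+\<omega>. fold_step \<nu> n F (abs_seq (walk_upto Z' n \<omega>)) \<partial>M')"
    by (intro Suc.IH borel_measurable_fold_step fold_step_mono fold_step_le_1 F)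
  also have "\<dots> = (\<integral>\<^sup>+\<omega>. F (abs_seq (walk_upto Z' (Suc n) \<omega>)) \<partial>M')"
    by (rule nn_integral_abs_walk_upto_Suc[OF N' F(1), symmetric])
  finally show ?case .
qed

section \<open>From finitely many coordinates to infinitely many\<close>

text \<open>This serves both to close the finite-dimensional upper sets generated by a compact set and to
  identify their intersection; in the second use \<open>Y\<close> is constant and the inequality in coordinate
  \<open>i\<close> holds only from \<open>k = i\<close> on.\<close>
lemma compact_coordinatewise_le_limit:
  fixes K :: "(nat \<Rightarrow> real) set"
  assumes K: "compact K" and X: "\<And>k. X k \<in> K" and Y: "Y \<longlonglongrightarrow> y"
    and le: "\<And>i. i \<in> I \<Longrightarrow> \<forall>\<^sub>F k in sequentially. X k i \<le> Y k i"
  shows "\<exists>x\<in>K. \<forall>i\<in>I. x i \<le> y i"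
proof -
  have coord: "(\<lambda>k. S k i) \<longlonglongrightarrow> s i" if "S \<longlonglongrightarrow> s" for S :: "nat \<Rightarrow> nat \<Rightarrow> real" and s i
    using continuous_on_tendsto_compose[where f = "\<lambda>x. x i" and s = UNIV, OF continuous_on_product_coordinates that] by simp
  have "seq_compact K" using K by (simp add: compact_eq_seq_compact_metric)
  then obtain x r where x: "x \<in> K" "strict_mono r" "(X \<circ> r) \<longlonglongrightarrow> x"
    using X by (elim seq_compactE) auto
  have "x i \<le> y i" if "i \<in> I" for i
  proof (rule tendsto_le[OF sequentially_bot])
    show "(\<lambda>k. Y (r k) i) \<longlonglongrightarrow> y i"
      using coord[OF LIMSEQ_subseq_LIMSEQ[OF Y x(2)]] by (simp add: o_def)
    show "(\<lambda>k. X (r k) i) \<longlonglongrightarrow> x i"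
      using coord[OF x(3)] by (simp add: o_def)
    show "\<forall>\<^sub>F k in sequentially. X (r k) i \<le> Y (r k) i"
      using eventually_subseq[OF x(2) le[OF that]] .
  qed
  with x(1) show ?thesis by blast
qed

text \<open>On finitely many coordinates only closed upper sets have to be compared: inner regularity of \<open>P\<close>
  reduces \<open>A\<close> to a compact subset, whose upward closure is a decreasing limit of such sets.\<close>
lemma emeasure_upper_set_mono:
  fixes P Q :: "(nat \<Rightarrow> real) measure"
  assumes P: "prob_space P" "sets P = sets borel" and Q: "prob_space Q" "sets Q = sets borel"
    and finite_dim: "\<And>n B. closed B \<Longrightarrow> (\<And>x y. x \<in> B \<Longrightarrow> \<forall>i\<le>n. x i \<le> y i \<Longrightarrow> y \<in> B) \<Longrightarrow>
      emeasure P B \<le> emeasure Q B"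
    and A: "A \<in> sets borel" and upper: "\<And>x y. x \<in> A \<Longrightarrow> x \<le> y \<Longrightarrow> y \<in> A"
  shows "emeasure P A \<le> emeasure Q A"
proof -
  interpret P: prob_space P by fact
  interpret Q: prob_space Q by fact
  have "emeasure P A = (SUP K\<in>{K. K \<subseteq> A \<and> compact K}. emeasure P K)"
    by (rule inner_regular) (use P.emeasure_finite A P(2) in auto)
  also have "\<dots> \<le> emeasure Q A"
  proof (rule SUP_least)
    fix K assume "K \<in> {K. K \<subseteq> A \<and> compact K}"
    then have KA: "K \<subseteq> A" and K: "compact K" by auto
    define B where "B = (\<lambda>n. {y. \<exists>x\<in>K. \<forall>i\<le>n. x i \<le> y i})"
    have KB: "K \<subseteq> B n" for n by (auto simp: B_def)
    have up: "y \<in> B n" if "x \<in> B n" "\<forall>i\<le>n. x i \<le> y i" for x y n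
    proof -
      obtain w where "w \<in> K" "\<forall>i\<le>n. w i \<le> x i" using \<open>x \<in> B n\<close> by (auto simp: B_def)
      with that(2) show ?thesis unfolding B_def by (auto intro!: bexI[of _ w] intro: order_trans)
    qed
    have closed: "closed (B n)" for n
      unfolding closed_sequential_limits
    proof (intro allI impI, elim conjE)
      fix Y y assume Y: "\<forall>k. Y k \<in> B n" and lim: "Y \<longlonglongrightarrow> y"
      then obtain X where X: "\<And>k. X k \<in> K \<and> (\<forall>i\<le>n. X k i \<le> Y k i)"
        unfolding B_def by simp metis
      have "\<exists>x\<in>K. \<forall>i\<in>{..n}. x i \<le> y i"
        by (rule compact_coordinatewise_le_limit[OF K _ lim, of X]) (use X in auto)
      then show "y \<in> B n" by (auto simp: B_def)
    qed
    have BA: "(\<Inter>n. B n) \<subseteq> A"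
    proof
      fix y assume "y \<in> (\<Inter>n. B n)"
      then obtain X where X: "\<And>k. X k \<in> K \<and> (\<forall>i\<le>k. X k i \<le> y i)"
        unfolding B_def by simp metis
      have "\<exists>x\<in>K. \<forall>i\<in>UNIV. x i \<le> y i"
      proof (rule compact_coordinatewise_le_limit[OF K, of X "\<lambda>_. y"])
        show "\<forall>\<^sub>F k in sequentially. X k i \<le> y i" for i
          using eventually_ge_at_top[of i] by eventually_elim (use X in auto)
      qed (use X in auto)
      then obtain x where "x \<in> K" "x \<le> y" by (auto simp: le_fun_def)
      with KA upper show "y \<in> A" by blast
    qed
    have Bsets: "B n \<in> sets Q" "B n \<in> sets P" for n
      using closed P(2) Q(2) by auto
    have "emeasure P K \<le> emeasure Q (B n)" for n
    proof -
      have "emeasure P K \<le> emeasure P (B n)"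
        by (rule emeasure_mono[OF KB Bsets(2)])
      also have "\<dots> \<le> emeasure Q (B n)"
        by (rule finite_dim[of "B n" n, OF closed]) (rule up)
      finally show ?thesis .
    qed
    then have "emeasure P K \<le> (INF n. emeasure Q (B n))" by (rule INF_greatest)
    also have "\<dots> = emeasure Q (\<Inter>n. B n)"
    proof (rule INF_emeasure_decseq)
      show "decseq B" unfolding decseq_def B_def by (auto intro: order_trans)
    qed (use Bsets Q.emeasure_finite in auto)
    also have "\<dots> \<le> emeasure Q A"
      by (rule emeasure_mono[OF BA]) (use A Q(2) in simp)
    finally show "emeasure P K \<le> emeasure Q A" .
  qed
  finally show ?thesis .
qed

lemma nn_integral_layer_cake:
  assumes "sigma_finite_measure P" and [measurable]: "g \<in> borel_measurable P" and g0: "\<And>x. 0 \<le> g x"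
  shows "(\<integral>\<^sup>+x. ennreal (g x) \<partial>P) =
    (\<integral>\<^sup>+t. indicator {0..} t * emeasure P {x\<in>space P. t < g x} \<partial>lborel)"
proof -
  interpret P: sigma_finite_measure P by fact
  interpret pair_sigma_finite P lborel ..
  have "(\<integral>\<^sup>+x. ennreal (g x) \<partial>P) = (\<integral>\<^sup>+x. (\<integral>\<^sup>+t. indicator {0..} t * (if t < g x then 1 else 0) \<partial>lborel) \<partial>P)"
  proof (rule nn_integral_cong)
    fix x
    have "(\<integral>\<^sup>+t. indicator {0..} t * (if t < g x then 1 else 0) \<partial>lborel) = (\<integral>\<^sup>+t. indicator {0..<g x} t \<partial>lborel)"
      by (intro nn_integral_cong) (auto simp: indicator_def)
    then show "ennreal (g x) = (\<integral>\<^sup>+t. indicator {0..} t * (if t < g x then 1 else 0) \<partial>lborel)"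
      using g0[of x] by simp
  qed
  also have "\<dots> = (\<integral>\<^sup>+t. (\<integral>\<^sup>+x. indicator {0..} t * (if t < g x then 1 else 0) \<partial>P) \<partial>lborel)"
    by (rule Fubini'[symmetric]) measurable
  also have "\<dots> = (\<integral>\<^sup>+t. indicator {0..} t * emeasure P {x\<in>space P. t < g x} \<partial>lborel)"
  proof (rule nn_integral_cong)
    fix t :: real
    have "(\<integral>\<^sup>+x. (if t < g x then 1 else 0) \<partial>P) = (\<integral>\<^sup>+x. indicator {x\<in>space P. t < g x} x \<partial>P)"
      by (intro nn_integral_cong) (auto simp: indicator_def)
    then show "(\<integral>\<^sup>+x. indicator {0..} t * (if t < g x then 1 else 0) \<partial>P) = indicator {0..} t * emeasure P {x\<in>space P. t < g x}"
      by (simp add: nn_integral_cmult)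
  qed
  finally show ?thesis .
qed

text \<open>The superlevel sets of an increasing function are upper sets. Adding a bound \<open>C\<close> makes the function
  nonnegative, so that the layer-cake formula applies.\<close>
lemma stoch_leI_finite_dimensional:
  fixes U :: "'a \<Rightarrow> nat \<Rightarrow> real" and V :: "'b \<Rightarrow> nat \<Rightarrow> real"
  assumes M: "prob_space M" and U[measurable]: "U \<in> borel_measurable M"
    and N: "prob_space N" and V[measurable]: "V \<in> borel_measurable N"
    and finite_dim: "\<And>n B. closed B \<Longrightarrow> (\<And>x y. x \<in> B \<Longrightarrow> \<forall>i\<le>n. x i \<le> y i \<Longrightarrow> y \<in> B) \<Longrightarrow>
      (\<integral>\<^sup>+\<omega>. indicator B (U \<omega>) \<partial>M) \<le> (\<integral>\<^sup>+\<omega>. indicator B (V \<omega>) \<partial>N)"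
  shows "stoch_le M U N V"
  unfolding stoch_le_def
proof (intro conjI allI impI M U N V)
  fix f :: "(nat \<Rightarrow> real) \<Rightarrow> real"
  assume f[measurable]: "f \<in> borel_measurable borel" and bdd: "bounded (range f)" and "mono f"
  interpret M: prob_space M by fact
  interpret N: prob_space N by fact
  let ?P = "distr M borel U" and ?Q = "distr N borel V"
  interpret P: prob_space ?P by (rule M.prob_space_distr) simp
  interpret Q: prob_space ?Q by (rule N.prob_space_distr) simp
  obtain C where C: "\<bar>f x\<bar> \<le> C" for x
    using bdd by (auto simp: bounded_iff)
  define g where "g = (\<lambda>x. f x + C)"
  have g[measurable]: "g \<in> borel_measurable borel" unfolding g_def by measurable
  have g0: "0 \<le> g x" and g2C: "g x \<le> 2 * C" for x
    using C[of x] by (simp_all add: g_def abs_le_iff)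
  have upper: "emeasure ?P A \<le> emeasure ?Q A"
    if "A \<in> sets borel" "\<And>x y. x \<in> A \<Longrightarrow> x \<le> y \<Longrightarrow> y \<in> A" for A
  proof (rule emeasure_upper_set_mono[OF P.prob_space_axioms _ Q.prob_space_axioms])
    fix n and B :: "(nat \<Rightarrow> real) set"
    assume B: "closed B" "\<And>x y. x \<in> B \<Longrightarrow> \<forall>i\<le>n. x i \<le> y i \<Longrightarrow> y \<in> B"
    have [measurable]: "B \<in> sets borel" using B(1) by simp
    have "emeasure ?P B = (\<integral>\<^sup>+\<omega>. indicator B (U \<omega>) \<partial>M)" "emeasure ?Q B = (\<integral>\<^sup>+\<omega>. indicator B (V \<omega>) \<partial>N)"
      by (simp_all add: nn_integral_distr flip: nn_integral_indicator)
    then show "emeasure ?P B \<le> emeasure ?Q B" using finite_dim[OF B] by simp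
  qed (use that in auto)
  have "(\<integral>\<^sup>+x. ennreal (g x) \<partial>?P) \<le> (\<integral>\<^sup>+x. ennreal (g x) \<partial>?Q)"
  proof -
    have "emeasure ?P {x. t < g x} \<le> emeasure ?Q {x. t < g x}" for t
    proof (rule upper)
      show "y \<in> {x. t < g x}" if "x \<in> {x. t < g x}" "x \<le> y" for x y
        using that monoD[OF \<open>mono f\<close> that(2)] by (auto simp: g_def)
    qed measurable
    then show ?thesis
      by (subst (1 2) nn_integral_layer_cake)
         (auto simp: g0 P.sigma_finite_measure_axioms Q.sigma_finite_measure_axioms
           intro!: nn_integral_mono mult_left_mono)
  qed
  moreover have "(\<integral>\<^sup>+x. ennreal (g x) \<partial>?Q) < \<top>"
  proof -
    have "(\<integral>\<^sup>+x. ennreal (g x) \<partial>?Q) \<le> (\<integral>\<^sup>+x. ennreal (2 * C) \<partial>?Q)"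
      using g2C by (intro nn_integral_mono ennreal_leI)
    also have "\<dots> = ennreal (2 * C)"
      using Q.emeasure_space_1 by simp
    finally show ?thesis by (simp add: le_less_trans ennreal_less_top)
  qed
  ultimately have "(\<integral>x. g x \<partial>?P) \<le> (\<integral>x. g x \<partial>?Q)"
    using g0 by (simp add: integral_eq_nn_integral enn2real_mono)
  moreover have "(\<integral>x. g x \<partial>?P) = (\<integral>\<omega>. f (U \<omega>) \<partial>M) + C"
  proof -
    have "integrable M (\<lambda>\<omega>. f (U \<omega>))"
      by (rule M.integrable_const_bound[where B = C]) (use C in auto)
    then show ?thesis
      by (simp add: g_def integral_distr M.prob_space)
  qed
  moreover have "(\<integral>x. g x \<partial>?Q) = (\<integral>\<omega>. f (V \<omega>) \<partial>N) + C"
  proof -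
    have "integrable N (\<lambda>\<omega>. f (V \<omega>))"
      by (rule N.integrable_const_bound[where B = C]) (use C in auto)
    then show ?thesis
      by (simp add: g_def integral_distr N.prob_space)
  qed
  ultimately show "(\<integral>\<omega>. f (U \<omega>) \<partial>M) \<le> (\<integral>\<omega>. f (V \<omega>) \<partial>N)" by simp
qed

section \<open>Comparison of absolute walks\<close>

lemma indicator_abs_walk_eq_truncated:
  assumes up: "\<And>x y. x \<in> B \<Longrightarrow> \<forall>i\<le>n. x i \<le> y i \<Longrightarrow> y \<in> B"
  shows "indicator B (\<lambda>i. \<bar>walk Z i \<omega>\<bar>) = (indicator B (abs_seq (walk_upto Z n \<omega>)) :: ennreal)"
proof -
  have "(\<lambda>i. \<bar>walk Z i \<omega>\<bar>) \<in> B \<longleftrightarrow> abs_seq (walk_upto Z n \<omega>) \<in> B"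
    by (rule iffI; erule up) (simp_all add: abs_seq_def walk_upto_def)
  then show ?thesis by (simp add: indicator_def)
qed

lemma stoch_le_abs_walk:
  assumes N: "normal_steps M \<mu> Z" and N': "normal_steps M' \<nu> Z'" and drift: "\<bar>\<mu>\<bar> \<le> \<bar>\<nu>\<bar>"
  shows "stoch_le M (\<lambda>\<omega> n. \<bar>walk Z n \<omega>\<bar>) M' (\<lambda>\<omega> n. \<bar>walk Z' n \<omega>\<bar>)"
proof (rule stoch_leI_finite_dimensional)
  show "prob_space M" "prob_space M'" using N N' by (simp_all add: normal_steps_def)
  show "(\<lambda>\<omega> n. \<bar>walk Z n \<omega>\<bar>) \<in> borel_measurable M"
    using borel_measurable_walk[OF N] by (intro measurable_coordinatewise_then_product) simp
  show "(\<lambda>\<omega> n. \<bar>walk Z' n \<omega>\<bar>) \<in> borel_measurable M'"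
    using borel_measurable_walk[OF N'] by (intro measurable_coordinatewise_then_product) simp
  fix n and B :: "(nat \<Rightarrow> real) set"
  assume B: "closed B" and up: "\<And>x y. x \<in> B \<Longrightarrow> \<forall>i\<le>n. x i \<le> y i \<Longrightarrow> y \<in> B"
  have "(\<integral>\<^sup>+\<omega>. indicator B (abs_seq (walk_upto Z n \<omega>)) \<partial>M) \<le> (\<integral>\<^sup>+\<omega>. indicator B (abs_seq (walk_upto Z' n \<omega>)) \<partial>M')"
  proof (rule nn_integral_abs_walk_upto_mono[OF N N' drift])
    show "mono_on {x. \<forall>i. 0 \<le> x i} (indicator B :: _ \<Rightarrow> ennreal)"
    proof (rule mono_onI)
      fix x y :: "nat \<Rightarrow> real" assume "x \<le> y"
      then have "x \<in> B \<Longrightarrow> y \<in> B" by (intro up[of x y]) (simp_all add: le_fun_def)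
      then show "indicator B x \<le> (indicator B y :: ennreal)" by (auto simp: indicator_def)
    qed
    show "indicator B \<in> borel_measurable borel"
      using B by (intro borel_measurable_indicator) simp
    show "indicator B x \<le> (1 :: ennreal)" for x
      by (simp add: indicator_def)
  qed
  moreover have "indicator B (\<lambda>i. \<bar>walk Z i \<omega>\<bar>) = (indicator B (abs_seq (walk_upto Z n \<omega>)) :: ennreal)" for \<omega>
    by (rule indicator_abs_walk_eq_truncated) (rule up)
  moreover have "indicator B (\<lambda>i. \<bar>walk Z' i \<omega>\<bar>) = (indicator B (abs_seq (walk_upto Z' n \<omega>)) :: ennreal)" for \<omega>
    by (rule indicator_abs_walk_eq_truncated) (rule up)
  ultimately show "(\<integral>\<^sup>+\<omega>. indicator B (\<lambda>i. \<bar>walk Z i \<omega>\<bar>) \<partial>M) \<le> (\<integral>\<^sup>+\<omega>. indicator B (\<lambda>i. \<bar>walk Z' i \<omega>\<bar>) \<partial>M')"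
    by presburger
qed

theorem theorem4:
  fixes M' :: "'a measure" and M'' :: "'b measure"
    and Z' :: "nat \<Rightarrow> 'a \<Rightarrow> real" and Z'' :: "nat \<Rightarrow> 'b \<Rightarrow> real"
    and \<mu>' \<mu>'' :: real
  assumes "normal_steps M' \<mu>' Z'" and "normal_steps M'' \<mu>'' Z''"
  shows "(\<bar>\<mu>'\<bar> < \<bar>\<mu>''\<bar> \<longrightarrow>
            stoch_le M' (\<lambda>\<omega> n. \<bar>walk Z' n \<omega>\<bar>) M'' (\<lambda>\<omega> n. \<bar>walk Z'' n \<omega>\<bar>)) \<and>
         (\<mu>' \<le> \<mu>'' \<and> \<mu>'' \<le> 0 \<longrightarrow>
            stoch_le M'' (\<lambda>\<omega> n. \<bar>walk Z'' n \<omega>\<bar>) M' (\<lambda>\<omega> n. \<bar>walk Z' n \<omega>\<bar>)) \<and>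
         (0 \<le> \<mu>' \<and> \<mu>' \<le> \<mu>'' \<longrightarrow>
            stoch_le M' (\<lambda>\<omega> n. \<bar>walk Z' n \<omega>\<bar>) M'' (\<lambda>\<omega> n. \<bar>walk Z'' n \<omega>\<bar>))"
proof (intro conjI impI)
  show "stoch_le M' (\<lambda>\<omega> n. \<bar>walk Z' n \<omega>\<bar>) M'' (\<lambda>\<omega> n. \<bar>walk Z'' n \<omega>\<bar>)" if "\<bar>\<mu>'\<bar> < \<bar>\<mu>''\<bar>"
    using that by (intro stoch_le_abs_walk[OF assms]) simp
  show "stoch_le M'' (\<lambda>\<omega> n. \<bar>walk Z'' n \<omega>\<bar>) M' (\<lambda>\<omega> n. \<bar>walk Z' n \<omega>\<bar>)" if "\<mu>' \<le> \<mu>'' \<and> \<mu>'' \<le> 0"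
    using that by (intro stoch_le_abs_walk[OF assms(2,1)]) simp
  show "stoch_le M' (\<lambda>\<omega> n. \<bar>walk Z' n \<omega>\<bar>) M'' (\<lambda>\<omega> n. \<bar>walk Z'' n \<omega>\<bar>)" if "0 \<le> \<mu>' \<and> \<mu>' \<le> \<mu>''"
    using that by (intro stoch_le_abs_walk[OF assms]) simp
qed

end
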